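(* Let $G$ be a Fuchsian group of the first kind acting on $\mathbb D$ and let $n\ge3$ be an integer. Then $$\big(\sigma^A_n\big)^{-1}(0)\cap\mathcal T_S(G)=\{\mathbb 1_{\mathbb D}\},$$ i.e. the only $f\in\mathcal T_S(G)$ with $\sigma^A_n[f]\equiv0$ is the identity function $\mathbb 1_{\mathbb D}:z\mapsto z$ on $\mathbb D$.
   Context: $\mathbb D$ is the unit disc, $\hat{\mathbb C}$ the Riemann sphere. The $A$ series of higher Schwarzians is defined, for locally injective $f$, by $\sigma^A_3[f]=S_f=(f''/f')'-\tfrac12(f''/f')^2$ and $\sigma^A_{n+1}[f]=\sigma^A_n[f]'-(n-1)\frac{f''}{f'}\sigma^A_n[f]$ for $n\ge3$. The schlicht model of the Teichmüller space of $G$, $\mathcal T_S(G)$, is the set of schlicht (injective holomorphic) functions $f$ on $\mathbb D$ with $f(0)=0$, $f'(0)=1$, $f''(0)=0$ for which there exists an orientation-preserving quasiconformal homeomorphism $w:\hat{\mathbb C}\to\hat{\mathbb C}$ with $w|_{\mathbb D}=f$ that is compatible with $G$, i.e. $wGw^{-1}$ is again a Kleinian group (of Möbius transformations). *)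

theory Defs
  imports "HOL-Complex_Analysis.Complex_Analysis"
begin

section \<open>The Riemann sphere and its Moebius transformations\<close>

text \<open>The point at infinity is \<^term>\<open>None\<close>.\<close>

type_synonym sphere_point = "complex option"

definition Riemann_sphere :: "sphere_point topology" where
  "Riemann_sphere = Alexandroff_compactification euclidean"

definition moebius_map ::
    "complex \<Rightarrow> complex \<Rightarrow> complex \<Rightarrow> complex \<Rightarrow> sphere_point \<Rightarrow> sphere_point" where
  "moebius_map a b c d x = (case x of
      None \<Rightarrow> if c = 0 then None else Some (a / c)
    | Some z \<Rightarrow> if c * z + d = 0 then None else Some ((a * z + b) / (c * z + d)))"

definition is_moebius :: "(sphere_point \<Rightarrow> sphere_point) \<Rightarrow> bool" where
  "is_moebius g \<longleftrightarrow> (\<exists>a b c d. a * d - b * c \<noteq> 0 \<and> g = moebius_map a b c d)"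


section \<open>Kleinian and Fuchsian groups\<close>

definition moebius_group :: "(sphere_point \<Rightarrow> sphere_point) set \<Rightarrow> bool" where
  "moebius_group G \<longleftrightarrow> (\<forall>g\<in>G. is_moebius g) \<and> id \<in> G \<and>
     (\<forall>g\<in>G. \<forall>h\<in>G. g \<circ> h \<in> G) \<and> (\<forall>g\<in>G. inv g \<in> G)"

definition region_of_discontinuity ::
    "(sphere_point \<Rightarrow> sphere_point) set \<Rightarrow> sphere_point set" where
  "region_of_discontinuity G =
     {x. \<exists>U. openin Riemann_sphere U \<and> x \<in> U \<and> finite {g \<in> G. g ` U \<inter> U \<noteq> {}}}"

definition Kleinian_group :: "(sphere_point \<Rightarrow> sphere_point) set \<Rightarrow> bool" where
  "Kleinian_group G \<longleftrightarrow> moebius_group G \<and> region_of_discontinuity G \<noteq> {}"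

definition Fuchsian_group :: "(sphere_point \<Rightarrow> sphere_point) set \<Rightarrow> bool" where
  "Fuchsian_group G \<longleftrightarrow> Kleinian_group G \<and>
     (\<forall>g\<in>G. g ` (Some ` ball 0 1) = Some ` ball 0 1)"

text \<open>Limit points of a Fuchsian group on the unit disc: the accumulation points, in the
  Riemann sphere, of the orbits of points of the disc.\<close>

definition Fuchsian_limit_set ::
    "(sphere_point \<Rightarrow> sphere_point) set \<Rightarrow> sphere_point set" where
  "Fuchsian_limit_set G =
     (\<Union>z\<in>ball 0 1. Riemann_sphere derived_set_of {g (Some z) |g. g \<in> G})"

definition Fuchsian_group_first_kind :: "(sphere_point \<Rightarrow> sphere_point) set \<Rightarrow> bool" where
  "Fuchsian_group_first_kind G \<longleftrightarrow>
     Fuchsian_group G \<and> Fuchsian_limit_set G = Some ` sphere 0 1"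


section \<open>Quasiconformal homeomorphisms\<close>

definition absolutely_continuous_fun_on :: "real set \<Rightarrow> (real \<Rightarrow> complex) \<Rightarrow> bool" where
  "absolutely_continuous_fun_on S f \<longleftrightarrow>
     (\<forall>\<epsilon>>0. \<exists>\<delta>>0. \<forall>\<D> T. \<D> division_of T \<and> T \<subseteq> S \<and> (\<Sum>k\<in>\<D>. Sup k - Inf k) < \<delta> \<longrightarrow>
        (\<Sum>k\<in>\<D>. norm (f (Sup k) - f (Inf k))) < \<epsilon>)"

text \<open>Absolute continuity on lines (ACL).\<close>

definition ACL_on :: "complex set \<Rightarrow> (complex \<Rightarrow> complex) \<Rightarrow> bool" where
  "ACL_on U f \<longleftrightarrow> (\<forall>a b. cbox a b \<subseteq> U \<longrightarrow>
     (AE y in lebesgue. y \<in> {Im a..Im b} \<longrightarrow>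
        absolutely_continuous_fun_on {Re a..Re b} (\<lambda>x. f (Complex x y))) \<and>
     (AE x in lebesgue. x \<in> {Re a..Re b} \<longrightarrow>
        absolutely_continuous_fun_on {Im a..Im b} (\<lambda>y. f (Complex x y))))"

definition orientation_preserving_on :: "complex set \<Rightarrow> (complex \<Rightarrow> complex) \<Rightarrow> bool" where
  "orientation_preserving_on U f \<longleftrightarrow>
     (\<forall>z r. 0 < r \<and> cball z r \<subseteq> U \<longrightarrow> winding_number (f \<circ> circlepath z r) (f z) = 1)"

text \<open>The analytic definition of orientation-preserving quasiconformal maps on an open set \<open>U\<close>.
  With \<open>p\<close> and \<open>q\<close> the partial derivatives of \<open>f\<close> in the real and imaginary directions,
  \<open>(p + \<i> q) / 2\<close> and \<open>(p - \<i> q) / 2\<close> are the derivatives of \<open>f\<close> with respect to the conjugate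
  variable and to \<open>z\<close>; the dilatation bound \<open>k\<close> is \<open>(K - 1) / (K + 1)\<close>.\<close>

definition quasiconformal_on :: "real \<Rightarrow> complex set \<Rightarrow> (complex \<Rightarrow> complex) \<Rightarrow> bool" where
  "quasiconformal_on k U f \<longleftrightarrow>
     (\<exists>g. homeomorphism U (f ` U) f g) \<and> orientation_preserving_on U f \<and> ACL_on U f \<and>
     (AE z in lebesgue. z \<in> U \<longrightarrow> (\<exists>p q.
        ((\<lambda>t. f (z + of_real t)) has_vector_derivative p) (at 0) \<and>
        ((\<lambda>t. f (z + \<i> * of_real t)) has_vector_derivative q) (at 0) \<and>
        cmod ((p + \<i> * q) / 2) \<le> k * cmod ((p - \<i> * q) / 2)))"

text \<open>Quasiconformality on the sphere is quasiconformality with respect to the two standard charts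
  \<open>z\<close> and \<open>1/z\<close>, in the domain as well as in the range.\<close>

definition quasiconformal_sphere :: "(sphere_point \<Rightarrow> sphere_point) \<Rightarrow> bool" where
  "quasiconformal_sphere w \<longleftrightarrow>
     homeomorphic_map Riemann_sphere Riemann_sphere w \<and>
     (\<exists>k. 0 \<le> k \<and> k < 1 \<and>
       (\<forall>i \<in> {id, moebius_map 0 1 1 0}. \<forall>j \<in> {id, moebius_map 0 1 1 0}.
          quasiconformal_on k {z. (j \<circ> w \<circ> i) (Some z) \<noteq> None} (\<lambda>z. the ((j \<circ> w \<circ> i) (Some z)))))"


section \<open>The schlicht model of the Teichmueller space\<close>

text \<open>Functions on the disc are represented by functions that are \<^const>\<open>undefined\<close> outside it.\<close>

definition Teichmueller_schlicht ::
    "(sphere_point \<Rightarrow> sphere_point) set \<Rightarrow> (complex \<Rightarrow> complex) set" where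
  "Teichmueller_schlicht G =
     {f. f \<in> extensional (ball 0 1) \<and> f holomorphic_on ball 0 1 \<and> inj_on f (ball 0 1) \<and>
         f 0 = 0 \<and> deriv f 0 = 1 \<and> deriv (deriv f) 0 = 0 \<and>
         (\<exists>w. quasiconformal_sphere w \<and> (\<forall>z\<in>ball 0 1. w (Some z) = Some (f z)) \<and>
              Kleinian_group {w \<circ> g \<circ> inv w |g. g \<in> G})}"


section \<open>The \<open>A\<close> series of higher Schwarzians\<close>

definition pre_Schwarzian :: "(complex \<Rightarrow> complex) \<Rightarrow> complex \<Rightarrow> complex" where
  "pre_Schwarzian f z = deriv (deriv f) z / deriv f z"

definition Schwarzian :: "(complex \<Rightarrow> complex) \<Rightarrow> complex \<Rightarrow> complex" where
  "Schwarzian f z = deriv (pre_Schwarzian f) z - 1 / 2 * (pre_Schwarzian f z)\<^sup>2"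

text \<open>Only the indices \<open>n \<ge> 3\<close> are meaningful; smaller ones get the value at 3.\<close>

primrec higher_Schwarzian_A :: "nat \<Rightarrow> (complex \<Rightarrow> complex) \<Rightarrow> complex \<Rightarrow> complex" where
  "higher_Schwarzian_A 0 f = Schwarzian f"
| "higher_Schwarzian_A (Suc n) f =
     (if n < 3 then Schwarzian f
      else (\<lambda>z. deriv (higher_Schwarzian_A n f) z
                - (of_nat n - 1) * pre_Schwarzian f z * higher_Schwarzian_A n f z))"

end

theory Submission
  imports Defs
begin

text \<open>
  Let \<open>P\<^sub>k = \<sigma>\<^sub>k / f'\<^bsup>k-1\<^esup>\<close>, read as a function of \<open>w = f z\<close>. Then \<open>P\<^bsub>k+1\<^esub> = P\<^sub>k'\<close>, so \<open>\<sigma>\<^sub>n = 0\<close> makes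
  \<open>S\<^sub>f = P(f) f'\<^sup>2\<close> for a polynomial \<open>P\<close>. The quadratic differential \<open>P(w) dw\<^sup>2\<close> is invariant under the
  conjugated group. If \<open>P \<noteq> 0\<close>, comparing zeros and leading coefficients shows that each
  element of this group is affine with linear part a root of unity of order dividing \<open>deg P + 2\<close>. A
  discontinuous group of such maps has no finite limit points of orbits, whereas the limit set of the
  conjugated group is the image of the whole unit circle. So \<open>P = 0\<close>, i.e. \<open>S\<^sub>f = 0\<close>, and the
  normalisation forces \<open>f\<close> to be the identity.
\<close>

subsection \<open>Quasiconformality of the identity\<close>

text \<open>Over each interval of the division the increment is at most a constant times the length,
  so a fixed multiple of \<epsilon> serves as \<delta>.\<close>

lemma absolutely_continuous_fun_on_lipschitz:
  assumes lip: "\<And>x y. x \<in> S \<Longrightarrow> y \<in> S \<Longrightarrow> norm (f x - f y) \<le> L * \<bar>x - y\<bar>"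
  shows "absolutely_continuous_fun_on S f"
  unfolding absolutely_continuous_fun_on_def
proof (intro allI impI)
  fix \<epsilon> :: real
  assume "\<epsilon> > 0"
  \<comment> \<open>No sign is assumed for \<open>L\<close>; this choice is positive and dominates
    it, so dividing by it is safe.\<close>
  define M where "M = \<bar>L\<bar> + 1"
  have "M > 0" by (simp add: M_def)
  show "\<exists>\<delta>>0. \<forall>\<D> T. \<D> division_of T \<and> T \<subseteq> S \<and> (\<Sum>k\<in>\<D>. Sup k - Inf k) < \<delta> \<longrightarrow>
          (\<Sum>k\<in>\<D>. norm (f (Sup k) - f (Inf k))) < \<epsilon>"
  proof (intro exI[of _ "\<epsilon> / M"] conjI allI impI)
    show "\<epsilon> / M > 0" using \<open>\<epsilon> > 0\<close> \<open>M > 0\<close> by simp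
    fix \<D> T
    assume *: "\<D> division_of T \<and> T \<subseteq> S \<and> (\<Sum>k\<in>\<D>. Sup k - Inf k) < \<epsilon> / M"
    have "norm (f (Sup k) - f (Inf k)) \<le> M * (Sup k - Inf k)" if "k \<in> \<D>" for k
    proof -
      obtain a b where k: "k = cbox a b" "k \<noteq> {}" "k \<subseteq> T"
        using * \<open>k \<in> \<D>\<close> by (metis division_ofD(2,3,4))
      then have "a \<le> b" by simp
      with k have "Sup k = b" "Inf k = a" by (simp_all add: cbox_interval)
      moreover have "a \<in> S" "b \<in> S" using k * \<open>a \<le> b\<close> by auto
      moreover have "L * \<bar>b - a\<bar> \<le> M * (b - a)"
        using \<open>a \<le> b\<close> by (auto simp: M_def intro!: mult_right_mono)
      ultimately show ?thesis using lip[of b a] by simp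
    qed
    then have "(\<Sum>k\<in>\<D>. norm (f (Sup k) - f (Inf k))) \<le> M * (\<Sum>k\<in>\<D>. Sup k - Inf k)"
      unfolding sum_distrib_left by (rule sum_mono)
    also have "\<dots> < \<epsilon>" using * \<open>M > 0\<close> by (simp add: field_simps)
    finally show "(\<Sum>k\<in>\<D>. norm (f (Sup k) - f (Inf k))) < \<epsilon>" .
  qed
qed

text \<open>The constant may depend on the box, as it must for the inversion, which is not Lipschitz
  near 0. Every line through the box then gives an absolutely continuous function, so the
  almost-everywhere clauses hold without exceptional sets.\<close>

lemma ACL_on_locally_lipschitz:
  assumes "\<And>a b. cbox a b \<subseteq> U \<Longrightarrow>
     \<exists>L. \<forall>u\<in>cbox a b. \<forall>v\<in>cbox a b. norm (f u - f v) \<le> L * norm (u - v)"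
  shows "ACL_on U f"
  unfolding ACL_on_def
proof (intro allI impI)
  fix a b :: complex
  assume "cbox a b \<subseteq> U"
  then obtain L where L: "norm (f u - f v) \<le> L * norm (u - v)"
    if "u \<in> cbox a b" "v \<in> cbox a b" for u v
    using assms by blast
  have cb: "Complex x y \<in> cbox a b \<longleftrightarrow> x \<in> {Re a..Re b} \<and> y \<in> {Im a..Im b}" for x y
    by (simp add: in_cbox_complex_iff)
  have "absolutely_continuous_fun_on {Re a..Re b} (\<lambda>x. f (Complex x y))"
    if "y \<in> {Im a..Im b}" for y
  proof (rule absolutely_continuous_fun_on_lipschitz)
    fix x x' assume "x \<in> {Re a..Re b}" "x' \<in> {Re a..Re b}"
    then show "norm (f (Complex x y) - f (Complex x' y)) \<le> L * \<bar>x - x'\<bar>"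
      using L[of "Complex x y" "Complex x' y"] that unfolding cb
      by (simp add: complex_diff cmod_def)
  qed
  moreover have "absolutely_continuous_fun_on {Im a..Im b} (\<lambda>y. f (Complex x y))"
    if "x \<in> {Re a..Re b}" for x
  proof (rule absolutely_continuous_fun_on_lipschitz)
    fix y y' assume "y \<in> {Im a..Im b}" "y' \<in> {Im a..Im b}"
    then show "norm (f (Complex x y) - f (Complex x y')) \<le> L * \<bar>y - y'\<bar>"
      using L[of "Complex x y" "Complex x y'"] that unfolding cb
      by (simp add: complex_diff cmod_def)
  qed
  ultimately show "(AE y in lebesgue. y \<in> {Im a..Im b} \<longrightarrow>
        absolutely_continuous_fun_on {Re a..Re b} (\<lambda>x. f (Complex x y))) \<and>
     (AE x in lebesgue. x \<in> {Re a..Re b} \<longrightarrow>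
        absolutely_continuous_fun_on {Im a..Im b} (\<lambda>y. f (Complex x y)))"
    by simp
qed

text \<open>Complex differentiability gives the partial derivatives \<open>p = D\<close> and
  \<open>q = \<i> * D\<close>, so \<open>p + \<i> * q = 0\<close>: the derivative with respect to
  the conjugate variable vanishes.\<close>

lemma dilatation_conformal:
  assumes D: "(f has_field_derivative D) (at z)" and "k \<ge> 0"
  shows "\<exists>p q. ((\<lambda>t. f (z + of_real t)) has_vector_derivative p) (at 0) \<and>
        ((\<lambda>t. f (z + \<i> * of_real t)) has_vector_derivative q) (at 0) \<and>
        cmod ((p + \<i> * q) / 2) \<le> k * cmod ((p - \<i> * q) / 2)"
proof (intro exI conjI)
  have *: "((\<lambda>t. f (z + c * of_real t)) has_vector_derivative (c * D)) (at 0)" for c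
  proof -
    have "((\<lambda>t. z + c * t) has_field_derivative c) (at (of_real 0))"
      by (auto intro!: derivative_eq_intros)
    then have "((\<lambda>t. f (z + c * t)) has_field_derivative D * c) (at (of_real 0))"
      using DERIV_chain2[of f D "\<lambda>t. z + c * t"] D by simp
    then show ?thesis
      using has_vector_derivative_real_field by (fastforce simp: mult.commute)
  qed
  show "((\<lambda>t. f (z + of_real t)) has_vector_derivative D) (at 0)" using *[of 1] by simp
  show "((\<lambda>t. f (z + \<i> * of_real t)) has_vector_derivative \<i> * D) (at 0)" using *[of \<i>] .
  have "\<i> * (\<i> * D) = - D" by (simp add: complex_eq_iff)
  then show "cmod ((D + \<i> * (\<i> * D)) / 2) \<le> k * cmod ((D - \<i> * (\<i> * D)) / 2)"
    using \<open>k \<ge> 0\<close> by simp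
qed

lemma quasiconformal_on_id: "quasiconformal_on 0 UNIV (\<lambda>z. z)"
  unfolding quasiconformal_on_def
proof (intro conjI)
  show "\<exists>g. homeomorphism UNIV ((\<lambda>z. z) ` UNIV) (\<lambda>z::complex. z) g"
    by (rule exI[of _ "\<lambda>z. z"]) (auto simp: homeomorphism_def)
  show "orientation_preserving_on UNIV (\<lambda>z. z)"
    by (auto simp: orientation_preserving_on_def o_def winding_number_circlepath)
  show "ACL_on UNIV (\<lambda>z. z)"
    by (rule ACL_on_locally_lipschitz, rule exI[of _ 1]) auto
  show "AE z in lebesgue. z \<in> UNIV \<longrightarrow> (\<exists>p q.
        ((\<lambda>t. (z + of_real t)) has_vector_derivative p) (at 0) \<and>
        ((\<lambda>t. (z + \<i> * of_real t)) has_vector_derivative q) (at 0) \<and>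
        cmod ((p + \<i> * q) / 2) \<le> 0 * cmod ((p - \<i> * q) / 2))"
    by (intro AE_I2 impI, rule dilatation_conformal[OF DERIV_ident order_refl])
qed

text \<open>Substituting \<open>v = inverse u\<close> turns the integrand
  \<open>1 / (v - inverse z)\<close> into \<open>1 / (u - z) - 1 / u\<close>. The first term
  integrates to \<open>2 * pi * \<i>\<close>, the second to 0 because the origin lies outside the
  closed disc.\<close>

lemma winding_number_inverse_circlepath:
  assumes "0 < r" "0 \<notin> cball z r"
  shows "winding_number (inverse \<circ> circlepath z r) (inverse z) = 1"
proof -
  have "z \<noteq> 0" using assms by auto
  have nz: "u \<noteq> 0" "u \<noteq> z" if "u \<in> path_image (circlepath z r)" for u
    using assms that by (auto simp: dist_norm)
  have pw: "deriv inverse u * (1 / (inverse u - inverse z)) = 1 / (u - z) - 1 / u"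
    if "u \<in> path_image (circlepath z r)" for u
  proof -
    have "u \<noteq> 0" "u - z \<noteq> 0" using nz[OF that] by auto
    then have "deriv inverse u = - (inverse u ^ 2)"
      using DERIV_imp_deriv[OF DERIV_inverse[of u UNIV]] by (simp add: numeral_2_eq_2)
    moreover have "inverse u - inverse z = - (u - z) / (u * z)"
      using \<open>u \<noteq> 0\<close> \<open>z \<noteq> 0\<close> by (simp add: field_simps)
    ultimately have "deriv inverse u * (1 / (inverse u - inverse z)) = z / (u * (u - z))"
      using \<open>u \<noteq> 0\<close> \<open>z \<noteq> 0\<close> \<open>u - z \<noteq> 0\<close> by (simp add: divide_simps power2_eq_square) (simp add: algebra_simps)
    also have "\<dots> = 1 / (u - z) - 1 / u"
      using \<open>u \<noteq> 0\<close> \<open>u - z \<noteq> 0\<close> by (simp add: diff_frac_eq)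
    finally show ?thesis .
  qed
  have sub: "path_image (circlepath z r) \<subseteq> - {0}" using nz(1) by blast
  have vp: "valid_path (inverse \<circ> circlepath z r)"
    by (rule valid_path_compose_holomorphic[where S="-{0}"])
       (use sub in \<open>auto intro!: holomorphic_intros\<close>)
  have notin: "inverse z \<notin> path_image (inverse \<circ> circlepath z r)"
    using nz by (auto simp: path_image_compose)
  have "contour_integral (inverse \<circ> circlepath z r) (\<lambda>v. 1 / (v - inverse z))
      = contour_integral (circlepath z r) (\<lambda>u. deriv inverse u * (1 / (inverse u - inverse z)))"
    by (rule contour_integral_comp_analyticW[where s="-{0}"])
       (use sub in \<open>auto intro!: analytic_intros\<close>)
  also have "\<dots> = contour_integral (circlepath z r) (\<lambda>u. 1 / (u - z) - 1 / u)"
    by (rule contour_integral_cong)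
       (use pw in auto)
  also have "\<dots> = 2 * pi * \<i>"
  proof (rule contour_integral_unique)
    have "((\<lambda>u. 1 / (u - z)) has_contour_integral 2 * pi * \<i>) (circlepath z r)"
      using has_contour_integral_winding_number[of "circlepath z r" z] assms
      by (simp add: winding_number_circlepath_centre)
    moreover have "((\<lambda>u. 1 / u) has_contour_integral 0) (circlepath z r)"
      by (rule Cauchy_theorem_convex_simple[where S="cball z r"])
         (use assms in \<open>auto intro!: holomorphic_intros\<close>)
    ultimately show "((\<lambda>u. 1 / (u - z) - 1 / u) has_contour_integral 2 * pi * \<i>) (circlepath z r)"
      using has_contour_integral_diff by fastforce
  qed
  finally show ?thesis
    using winding_number_valid_path[OF vp notin] by simp
qed

text \<open>The value at \<open>0\<close> is left open because the chart expression of the identity there is the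
  unspecified \<open>the None\<close>.\<close>

lemma quasiconformal_on_inverse:
  assumes f: "\<And>z. z \<noteq> 0 \<Longrightarrow> f z = inverse z"
  shows "quasiconformal_on 0 (- {0}) f"
  unfolding quasiconformal_on_def
proof (intro conjI)
  show "\<exists>g. homeomorphism (- {0}) (f ` (- {0})) f g"
  proof
    have im: "inverse ` (- {0}) = - {0 :: complex}"
    proof (intro equalityI subsetI)
      fix u :: complex
      assume "u \<in> - {0}"
      then show "u \<in> inverse ` (- {0})" by (intro image_eqI[of _ _ "inverse u"]) auto
    qed auto
    then have "homeomorphism (- {0}) (- {0}) (inverse :: complex \<Rightarrow> complex) inverse"
      by (auto simp: homeomorphism_def intro!: continuous_intros)
    moreover have "f ` (- {0}) = inverse ` (- {0})" by (rule image_cong) (use f in auto)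
    then have "f ` (- {0}) = - {0}" using im by simp
    ultimately show "homeomorphism (- {0}) (f ` (- {0})) f inverse"
      using f homeomorphism_cong[of "- {0}" "- {0}" inverse inverse "- {0}" "- {0}" f inverse] by simp
  qed
  show "orientation_preserving_on (- {0}) f"
    unfolding orientation_preserving_on_def
  proof (intro allI impI)
    fix z :: complex and r :: real
    assume *: "0 < r \<and> cball z r \<subseteq> - {0}"
    \<comment> \<open>The two paths are compared below as functions on the whole real line, so
      \<open>t\<close> is not confined to the unit interval.\<close>
    have "circlepath z r t \<in> cball z r" for t
      using * by (simp add: circlepath dist_norm norm_mult)
    then have "circlepath z r t \<noteq> 0" for t
      using * by blast
    then have "f \<circ> circlepath z r = inverse \<circ> circlepath z r"
      using f by (simp add: fun_eq_iff)
    moreover have "z \<in> cball z r" using * by simp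
    then have "f z = inverse z" using * by (intro f) blast
    ultimately show "winding_number (f \<circ> circlepath z r) (f z) = 1"
      using winding_number_inverse_circlepath[of r z] * by auto
  qed
  show "ACL_on (- {0}) f"
  proof (rule ACL_on_locally_lipschitz)
    fix a b :: complex
    assume ab: "cbox a b \<subseteq> - {0}"
    \<comment> \<open>On a compact box avoiding 0 the inverse is bounded by some \<open>B\<close>,
      and \<open>1/u - 1/v = (v - u)/(u v)\<close> then gives the Lipschitz constant
      \<open>B * B\<close>.\<close>
    have "compact (inverse ` cbox a b)"
      by (rule compact_continuous_image) (use ab in \<open>auto intro!: continuous_intros\<close>)
    then obtain B where B: "norm (inverse u) \<le> B" if "u \<in> cbox a b" for u
      by (meson bounded_iff compact_imp_bounded imageI)
    have "norm (f u - f v) \<le> (B * B) * norm (u - v)"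
      if "u \<in> cbox a b" "v \<in> cbox a b" for u v
    proof -
      have "u \<noteq> 0" "v \<noteq> 0" using ab that by auto
      then have "inverse u - inverse v = (inverse u * inverse v) * (v - u)"
        by (simp add: field_simps)
      then have "norm (inverse u - inverse v) = (norm (inverse u) * norm (inverse v)) * norm (u - v)"
        by (simp add: norm_mult norm_minus_commute)
      also have "\<dots> \<le> (B * B) * norm (u - v)"
        using B[OF that(1)] B[OF that(2)]
        by (meson mult_mono mult_right_mono norm_ge_zero order_trans)
      finally show ?thesis using f \<open>u \<noteq> 0\<close> \<open>v \<noteq> 0\<close> by simp
    qed
    then show "\<exists>L. \<forall>u\<in>cbox a b. \<forall>v\<in>cbox a b. norm (f u - f v) \<le> L * norm (u - v)"
      by blast
  qed
  show "AE z in lebesgue. z \<in> - {0} \<longrightarrow> (\<exists>p q.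
        ((\<lambda>t. f (z + of_real t)) has_vector_derivative p) (at 0) \<and>
        ((\<lambda>t. f (z + \<i> * of_real t)) has_vector_derivative q) (at 0) \<and>
        cmod ((p + \<i> * q) / 2) \<le> 0 * cmod ((p - \<i> * q) / 2))"
  proof (intro AE_I2 impI, rule dilatation_conformal[OF _ order_refl])
    fix z :: complex
    assume "z \<in> - {0}"
    then show "(f has_field_derivative - (inverse z ^ Suc (Suc 0))) (at z)"
      using has_field_derivative_transform_within_open[OF DERIV_inverse[of z UNIV], of "- {0}" f] f
      by auto
  qed
qed

text \<open>The identity reads as \<open>z\<close> when the charts in domain and range agree and as
  \<open>1/z\<close> when they differ. Both are conformal, so the dilatation bound 0 works.\<close>

lemma quasiconformal_sphere_id: "quasiconformal_sphere id"
proof -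
  let ?J = "moebius_map 0 1 1 0"
  have J: "?J (Some z) = (if z = 0 then None else Some (inverse z))" for z
    by (simp add: moebius_map_def inverse_eq_divide)
  have JJ: "?J \<circ> ?J = id"
  proof
    show "(?J \<circ> ?J) x = id x" for x
      by (cases x) (auto simp: moebius_map_def)
  qed
  have "{z. ?J (Some z) \<noteq> None} = - {0}" by (auto simp: J)
  moreover have "quasiconformal_on 0 (- {0}) (\<lambda>z. the (?J (Some z)))"
    by (rule quasiconformal_on_inverse) (simp add: J)
  ultimately have "quasiconformal_on 0 {z. ?J (Some z) \<noteq> None} (\<lambda>z. the (?J (Some z)))" by simp
  moreover have "quasiconformal_on 0 {z. id (Some z) \<noteq> None} (\<lambda>z. the (id (Some z)))"
    using quasiconformal_on_id by simp
  ultimately have "\<forall>i \<in> {id, ?J}. \<forall>j \<in> {id, ?J}.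
      quasiconformal_on 0 {z. (j \<circ> id \<circ> i) (Some z) \<noteq> None} (\<lambda>z. the ((j \<circ> id \<circ> i) (Some z)))"
    by (simp add: JJ del: id_apply o_apply)
  moreover have "homeomorphic_map Riemann_sphere Riemann_sphere id"
    by (simp add: homeomorphic_map_id)
  ultimately show ?thesis
    unfolding quasiconformal_sphere_def by (intro conjI exI[of _ 0]) auto
qed

subsection \<open>The Schwarzian derivative\<close>

lemma deriv_eq_on_open:
  assumes "open S" "z \<in> S" "\<And>u. u \<in> S \<Longrightarrow> f u = g u"
  shows "deriv f z = deriv g z"
  by (rule deriv_cong_ev) (use assms eventually_nhds in blast)+

lemma Schwarzian_eq_on_open:
  assumes "open S" "z \<in> S" "\<And>u. u \<in> S \<Longrightarrow> f u = g u"
  shows "Schwarzian f z = Schwarzian g z"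
proof -
  have 1: "deriv f u = deriv g u" if "u \<in> S" for u
    by (rule deriv_eq_on_open[OF assms(1) that assms(3)])
  have 2: "deriv (deriv f) u = deriv (deriv g) u" if "u \<in> S" for u
    by (rule deriv_eq_on_open[OF assms(1) that 1])
  have 3: "pre_Schwarzian f u = pre_Schwarzian g u" if "u \<in> S" for u
    by (simp add: pre_Schwarzian_def 1 2 that)
  show ?thesis
    unfolding Schwarzian_def
    by (simp add: deriv_eq_on_open[OF assms(1,2) 3] 3[OF assms(2)])
qed

lemma deriv_comp_on:
  assumes "open S" "open T" "g holomorphic_on S" "h holomorphic_on T" "g ` S \<subseteq> T" "z \<in> S"
  shows "deriv (\<lambda>u. h (g u)) z = deriv h (g z) * deriv g z"
  using assms
  by (intro DERIV_imp_deriv DERIV_chain2 holomorphic_derivI[of h T] holomorphic_derivI[of g S]) auto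

lemma pre_Schwarzian_holomorphic_on [holomorphic_intros]:
  assumes "open S" "f holomorphic_on S" "\<And>z. z \<in> S \<Longrightarrow> deriv f z \<noteq> 0"
  shows "pre_Schwarzian f holomorphic_on S"
proof -
  have "(\<lambda>z. deriv (deriv f) z / deriv f z) holomorphic_on S"
    using assms by (intro holomorphic_intros) auto
  then show ?thesis by (simp add: pre_Schwarzian_def [abs_def])
qed

lemma Schwarzian_holomorphic_on:
  assumes "open S" "f holomorphic_on S" "\<And>z. z \<in> S \<Longrightarrow> deriv f z \<noteq> 0"
  shows "Schwarzian f holomorphic_on S"
  unfolding Schwarzian_def [abs_def] using assms by (intro holomorphic_intros) auto

text \<open>The pre-Schwarzian is the logarithmic derivative of the first derivative, so the product
  in the chain rule becomes a sum.\<close>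

lemma pre_Schwarzian_comp:
  assumes S: "open S" and T: "open T" and g: "g holomorphic_on S" and h: "h holomorphic_on T"
    and gST: "g ` S \<subseteq> T"
    and g0: "\<And>z. z \<in> S \<Longrightarrow> deriv g z \<noteq> 0" and h0: "\<And>z. z \<in> T \<Longrightarrow> deriv h z \<noteq> 0"
    and z: "z \<in> S"
  shows "pre_Schwarzian (\<lambda>u. h (g u)) z = pre_Schwarzian h (g z) * deriv g z + pre_Schwarzian g z"
proof -
  have gT: "g z \<in> T" if "z \<in> S" for z using gST that by auto
  have d1: "deriv (\<lambda>u. h (g u)) z = deriv h (g z) * deriv g z" if "z \<in> S" for z
    by (rule deriv_comp_on[OF S T g h gST that])
  have "deriv (deriv (\<lambda>u. h (g u))) z = deriv (\<lambda>u. deriv h (g u) * deriv g u) z"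
    by (rule deriv_eq_on_open[OF S z d1])
  also have "\<dots> = (deriv (deriv h) (g z) * deriv g z) * deriv g z + deriv (deriv g) z * deriv h (g z)"
    using z gT
    by (intro DERIV_imp_deriv DERIV_mult DERIV_chain2[of "deriv h"]
          holomorphic_derivI[of _ T] holomorphic_derivI[of _ S] holomorphic_deriv S T g h) auto
  finally show ?thesis
    using g0[OF z] h0[OF gT[OF z]] d1[OF z]
    by (simp add: pre_Schwarzian_def field_simps)
qed

text \<open>The cocycle rule. Differentiating the formula for the pre-Schwarzian leaves a mixed term
  with the second derivative of \<open>g\<close>; it cancels against the cross term of the
  square.\<close>

lemma Schwarzian_comp:
  assumes S: "open S" and T: "open T" and g: "g holomorphic_on S" and h: "h holomorphic_on T"
    and gST: "g ` S \<subseteq> T"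
    and g0: "\<And>z. z \<in> S \<Longrightarrow> deriv g z \<noteq> 0" and h0: "\<And>z. z \<in> T \<Longrightarrow> deriv h z \<noteq> 0"
    and z: "z \<in> S"
  shows "Schwarzian (\<lambda>u. h (g u)) z = Schwarzian h (g z) * (deriv g z)\<^sup>2 + Schwarzian g z"
proof -
  have gT: "g z \<in> T" if "z \<in> S" for z using gST that by auto
  have p: "pre_Schwarzian (\<lambda>u. h (g u)) z = pre_Schwarzian h (g z) * deriv g z + pre_Schwarzian g z"
    if "z \<in> S" for z
    by (rule pre_Schwarzian_comp[OF S T g h gST]) (use g0 h0 that in auto)
  have "deriv (pre_Schwarzian (\<lambda>u. h (g u))) z
      = deriv (\<lambda>u. pre_Schwarzian h (g u) * deriv g u + pre_Schwarzian g u) z"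
    by (rule deriv_eq_on_open[OF S z p])
  also have "\<dots> = ((deriv (pre_Schwarzian h) (g z) * deriv g z) * deriv g z
       + deriv (deriv g) z * pre_Schwarzian h (g z)) + deriv (pre_Schwarzian g) z"
    using z gT
    by (intro DERIV_imp_deriv DERIV_add DERIV_mult DERIV_chain2[of "pre_Schwarzian h"]
          holomorphic_derivI[of _ T] holomorphic_derivI[of _ S] holomorphic_deriv S T g h
          pre_Schwarzian_holomorphic_on g0 h0) auto
  finally have *: "deriv (pre_Schwarzian (\<lambda>u. h (g u))) z = \<dots>" .
  have "deriv (deriv g) z = pre_Schwarzian g z * deriv g z"
    using g0[OF z] by (simp add: pre_Schwarzian_def)
  then show ?thesis
    unfolding Schwarzian_def * p[OF z] by (simp add: power2_eq_square field_simps)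
qed

section \<open>Moebius maps and their Schwarzian\<close>

lemma moebius_has_field_derivative:
  fixes a b c d z :: complex
  assumes "c * z + d \<noteq> 0"
  shows "((\<lambda>z. (a * z + b) / (c * z + d)) has_field_derivative (a * d - b * c) / (c * z + d)\<^sup>2) (at z)"
  using assms by (auto intro!: derivative_eq_intros simp: field_simps power2_eq_square)

lemma deriv_moebius:
  fixes a b c d z :: complex
  assumes "c * z + d \<noteq> 0"
  shows "deriv (\<lambda>z. (a * z + b) / (c * z + d)) z = (a * d - b * c) / (c * z + d)\<^sup>2"
  using DERIV_imp_deriv[OF moebius_has_field_derivative[OF assms]] .

lemma open_moebius_domain: "open {z :: complex. c * z + d \<noteq> 0}"
  by (intro open_Collect_neq continuous_intros)

text \<open>The pre-Schwarzian is \<open>- 2 * c / (c * z + d)\<close>, and its derivative is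
  exactly half its square.\<close>

lemma Schwarzian_moebius:
  fixes a b c d z :: complex
  assumes det: "a * d - b * c \<noteq> 0" and z: "c * z + d \<noteq> 0"
  shows "Schwarzian (\<lambda>z. (a * z + b) / (c * z + d)) z = 0"
proof -
  let ?m = "\<lambda>z. (a * z + b) / (c * z + d)" and ?S = "{z. c * z + d \<noteq> 0}"
  have p: "pre_Schwarzian ?m u = - 2 * c / (c * u + d)" if u: "u \<in> ?S" for u
  proof -
    have "deriv (deriv ?m) u = deriv (\<lambda>z. (a * d - b * c) / (c * z + d)\<^sup>2) u"
      by (rule deriv_eq_on_open[OF open_moebius_domain u]) (simp add: deriv_moebius)
    also have "\<dots> = - 2 * c * (a * d - b * c) / (c * u + d) ^ 3"
      using u by (intro DERIV_imp_deriv)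
        (auto intro!: derivative_eq_intros simp: divide_simps power2_eq_square power3_eq_cube)
    finally have "deriv (deriv ?m) u = - 2 * c * (a * d - b * c) / (c * u + d) ^ 3" .
    moreover have "deriv ?m u = (a * d - b * c) / (c * u + d)\<^sup>2"
      using u by (simp add: deriv_moebius)
    ultimately show ?thesis
      unfolding pre_Schwarzian_def
      using u det by (simp only:) (simp add: divide_simps power2_eq_square power3_eq_cube)
  qed
  have "deriv (pre_Schwarzian ?m) z = deriv (\<lambda>u. - 2 * c / (c * u + d)) z"
    by (rule deriv_eq_on_open[OF open_moebius_domain _ p]) (use z in auto)
  also have "\<dots> = 2 * c\<^sup>2 / (c * z + d)\<^sup>2"
    using z by (intro DERIV_imp_deriv)
      (auto intro!: derivative_eq_intros simp: divide_simps power2_eq_square)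
  finally have "deriv (pre_Schwarzian ?m) z = 2 * c\<^sup>2 / (c * z + d)\<^sup>2" .
  moreover have "pre_Schwarzian ?m z = - 2 * c / (c * z + d)" using p z by simp
  ultimately show ?thesis
    unfolding Schwarzian_def by (simp only:) (simp add: power2_eq_square)
qed

subsection \<open>Higher Schwarzians as derivatives in the image coordinate\<close>

lemma higher_Schwarzian_A_Suc:
  assumes "n \<ge> 3"
  shows "higher_Schwarzian_A (Suc n) f z =
    deriv (higher_Schwarzian_A n f) z - (of_nat n - 1) * pre_Schwarzian f z * higher_Schwarzian_A n f z"
  using assms by simp

lemma higher_Schwarzian_A_3: "higher_Schwarzian_A 3 f = Schwarzian f"
  by (simp add: numeral_3_eq_3)

lemma higher_Schwarzian_A_holomorphic_on:
  assumes "open S" "f holomorphic_on S" "\<And>z. z \<in> S \<Longrightarrow> deriv f z \<noteq> 0"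
  shows "higher_Schwarzian_A n f holomorphic_on S"
proof (induction n)
  case 0
  then show ?case using Schwarzian_holomorphic_on[OF assms] by simp
next
  case (Suc n)
  have "(\<lambda>z. deriv (higher_Schwarzian_A n f) z
      - (of_nat n - 1) * pre_Schwarzian f z * higher_Schwarzian_A n f z) holomorphic_on S"
    using assms Suc by (intro holomorphic_intros) auto
  then show ?case using Schwarzian_holomorphic_on[OF assms] by simp
qed

text \<open>Term-by-term integration; characteristic zero makes the divisors \<open>Suc i\<close>
  invertible.\<close>

lemma poly_antiderivative: "\<exists>R. pderiv R = Q" for Q :: "'a :: field_char_0 poly"
proof
  define R where "R = (\<Sum>i\<le>degree Q. monom (coeff Q i / of_nat (Suc i)) (Suc i))"
  show "pderiv R = Q"
  proof (rule poly_eqI)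
    fix i
    have "coeff R (Suc i) = (if i \<le> degree Q then coeff Q i / of_nat (Suc i) else 0)"
      by (simp add: R_def coeff_sum)
    then show "coeff (pderiv R) i = coeff Q i"
      by (simp add: coeff_pderiv coeff_eq_0 del: of_nat_Suc)
  qed
qed

text \<open>By the recursion, the derivative of the order-\<open>k\<close> Schwarzian over
  \<open>f'^(k-1)\<close> is the order-\<open>Suc k\<close> Schwarzian over the same power. By
  hypothesis that is \<open>Q(f) f'\<close>, so integrating \<open>Q\<close> recovers the quotient
  as a polynomial in \<open>f\<close>.\<close>

lemma higher_Schwarzian_A_polynomial_step:
  assumes S: "open S" "convex S" and f: "f holomorphic_on S" "\<And>z. z \<in> S \<Longrightarrow> deriv f z \<noteq> 0"
    and k: "k \<ge> 3"
    and Q: "\<And>z. z \<in> S \<Longrightarrow> higher_Schwarzian_A (Suc k) f z = poly Q (f z) * deriv f z ^ k"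
  shows "\<exists>R. \<forall>z\<in>S. higher_Schwarzian_A k f z = poly R (f z) * deriv f z ^ (k - 1)"
proof -
  obtain R where R: "pderiv R = Q" using poly_antiderivative by blast
  \<comment> \<open>With this shift the exponent \<open>k - 1\<close> is \<open>Suc m\<close>, and
    the power rule yields \<open>m\<close> without truncated subtraction.\<close>
  define m where "m = k - 2"
  have m: "k = Suc (Suc m)" using k by (simp add: m_def)
  let ?h = "higher_Schwarzian_A k f"
  \<comment> \<open>The quotient minus its expected antiderivative: it has zero derivative, and
    convexity of \<open>S\<close> makes it constant.\<close>
  define F where "F = (\<lambda>z. ?h z / deriv f z ^ Suc m - poly R (f z))"
  have "(F has_field_derivative 0) (at z within S)" if z: "z \<in> S" for z
  proof -
    have h: "(?h has_field_derivative deriv ?h z) (at z)"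
      using higher_Schwarzian_A_holomorphic_on[OF S(1) f] S z by (auto intro: holomorphic_derivI)
    have f1: "(f has_field_derivative deriv f z) (at z)"
      using S f z by (auto intro: holomorphic_derivI)
    have f2: "(deriv f has_field_derivative deriv (deriv f) z) (at z)"
      using S f z by (auto intro: holomorphic_derivI holomorphic_deriv)
    have f0: "deriv f z \<noteq> 0" using f z by blast
    have p: "((\<lambda>z. deriv f z ^ Suc m) has_field_derivative
        of_nat (Suc m) * deriv (deriv f) z * deriv f z ^ m) (at z)"
      using DERIV_power[OF f2, of "Suc m"] by (simp add: mult.assoc)
    have "deriv ?h z = poly Q (f z) * deriv f z ^ k
        + (of_nat k - 1) * (deriv (deriv f) z / deriv f z) * ?h z"
      using higher_Schwarzian_A_Suc[OF k, of f z]
      unfolding Q[OF z] pre_Schwarzian_def by (simp only: diff_eq_eq eq_diff_eq)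
    \<comment> \<open>The coefficient in the recursion equals the exponent of \<open>f'\<close> in
      the quotient, which is why the \<open>f''\<close> terms cancel in the quotient rule.\<close>
    moreover have "(of_nat k - 1 :: complex) = of_nat (Suc m)" by (simp add: m)
    ultimately have h': "deriv ?h z = poly Q (f z) * deriv f z * deriv f z ^ Suc m
        + of_nat (Suc m) * (deriv (deriv f) z / deriv f z) * ?h z"
      by (simp add: m)
    have "of_nat (Suc m) * (deriv (deriv f) z / deriv f z) * ?h z * deriv f z ^ Suc m
        = ?h z * (of_nat (Suc m) * deriv (deriv f) z * deriv f z ^ m)"
      using f0 by simp
    then have "deriv ?h z * deriv f z ^ Suc m - ?h z * (of_nat (Suc m) * deriv (deriv f) z * deriv f z ^ m)
        = (poly Q (f z) * deriv f z) * (deriv f z ^ Suc m * deriv f z ^ Suc m)"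
      unfolding h' by (simp only: distrib_right) (simp only: mult.assoc add_diff_cancel_right')
    then have "(deriv ?h z * deriv f z ^ Suc m
          - ?h z * (of_nat (Suc m) * deriv (deriv f) z * deriv f z ^ m))
          / (deriv f z ^ Suc m * deriv f z ^ Suc m) - poly (pderiv R) (f z) * deriv f z = 0"
      using f0 by (simp add: R)
    then have "(F has_field_derivative 0) (at z)"
      using DERIV_diff[OF DERIV_divide[OF h p] DERIV_chain2[OF poly_DERIV[of R] f1]] f0
      by (simp only: F_def) simp
    then show ?thesis
      by (rule has_field_derivative_at_within)
  qed
  then obtain c where c: "F z = c" if "z \<in> S" for z
    using has_field_derivative_zero_constant[OF S(2)] by blast
  \<comment> \<open>The constant of integration is absorbed into the polynomial.\<close>
  have "?h z = poly (R + [:c:]) (f z) * deriv f z ^ (k - 1)" if z: "z \<in> S" for z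
  proof -
    have "?h z / deriv f z ^ Suc m = poly R (f z) + c"
      using c[OF z] by (simp add: F_def diff_eq_eq add.commute)
    then show ?thesis using f(2)[OF z] by (simp add: m divide_eq_eq)
  qed
  then show ?thesis by blast
qed

text \<open>Descends from order \<open>n\<close>, where the zero polynomial serves, to order 3,
  integrating once at each step.\<close>

lemma higher_Schwarzian_A_zero_imp_polynomial:
  assumes S: "open S" "convex S" and f: "f holomorphic_on S" "\<And>z. z \<in> S \<Longrightarrow> deriv f z \<noteq> 0"
    and n: "n \<ge> 3" and zero: "\<And>z. z \<in> S \<Longrightarrow> higher_Schwarzian_A n f z = 0"
  shows "\<exists>P. \<forall>z\<in>S. Schwarzian f z = poly P (f z) * (deriv f z)\<^sup>2"
proof -
  have "\<exists>P. \<forall>z\<in>S. higher_Schwarzian_A 3 f z = poly P (f z) * deriv f z ^ (3 - 1)"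
    using n
  proof (induction rule: inc_induct)
    case base
    show ?case by (rule exI[of _ 0]) (simp add: zero)
  next
    case (step k)
    then show ?case
      using higher_Schwarzian_A_polynomial_step[OF S f, of k] by auto
  qed
  then show ?thesis by (simp add: higher_Schwarzian_A_3)
qed

text \<open>Writing \<open>p = f''/f'\<close>, a vanishing Schwarzian means
  \<open>p' = p^2/2\<close>. Together with \<open>f'' = p f'\<close> this makes
  \<open>p^2/f'\<close> constant. The normalisation at 0 makes the constant 0, so
  \<open>f'' = 0\<close> and two more integrations finish.\<close>

lemma Schwarzian_zero_imp_id:
  assumes S: "open S" "convex S" "0 \<in> S"
    and f: "f holomorphic_on S" "\<And>z. z \<in> S \<Longrightarrow> deriv f z \<noteq> 0"
    and f0: "f 0 = 0" "deriv f 0 = 1" "deriv (deriv f) 0 = 0"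
    and zero: "\<And>z. z \<in> S \<Longrightarrow> Schwarzian f z = 0"
    and z: "z \<in> S"
  shows "f z = z"
proof -
  let ?p = "pre_Schwarzian f"
  have f1: "(f has_field_derivative deriv f z) (at z)" if "z \<in> S" for z
    using S f that by (auto intro: holomorphic_derivI)
  have f2: "(deriv f has_field_derivative deriv (deriv f) z) (at z)" if "z \<in> S" for z
    using S f that by (auto intro: holomorphic_derivI holomorphic_deriv)
  have "((\<lambda>z. ?p z * ?p z / deriv f z) has_field_derivative 0) (at z within S)" if z: "z \<in> S" for z
  proof -
    have p': "deriv ?p z = ?p z * ?p z / 2"
      using zero[OF z] by (simp add: Schwarzian_def power2_eq_square)
    have p: "(?p has_field_derivative deriv ?p z) (at z)"
      using pre_Schwarzian_holomorphic_on[OF S(1) f] S z by (auto intro: holomorphic_derivI)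
    have "deriv (deriv f) z = ?p z * deriv f z"
      using f(2)[OF z] by (simp add: pre_Schwarzian_def)
    then have "((\<lambda>z. ?p z * ?p z / deriv f z) has_field_derivative 0) (at z)"
      using DERIV_divide[OF DERIV_mult[OF p p] f2[OF z] f(2)[OF z]] by (simp add: p')
    then show ?thesis by (rule has_field_derivative_at_within)
  qed
  then obtain c where c: "?p z * ?p z / deriv f z = c" if "z \<in> S" for z
    using has_field_derivative_zero_constant[OF S(2), of "\<lambda>z. ?p z * ?p z / deriv f z"] by blast
  have "c = 0" using c[OF S(3)] f0 by (simp add: pre_Schwarzian_def)
  then have dd: "deriv (deriv f) z = 0" if "z \<in> S" for z
    using c[OF that] f(2)[OF that] by (simp add: pre_Schwarzian_def)
  have "(deriv f has_field_derivative 0) (at z within S)" if "z \<in> S" for z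
    using f2[OF that] unfolding dd[OF that] by (rule has_field_derivative_at_within)
  then obtain c1 where c1: "deriv f z = c1" if "z \<in> S" for z
    using has_field_derivative_zero_constant[OF S(2), of "deriv f"] by blast
  have "deriv f z = 1" if "z \<in> S" for z using c1[OF that] c1[OF S(3)] f0 by simp
  then have "((\<lambda>z. f z - z) has_field_derivative 0) (at z within S)" if "z \<in> S" for z
    using DERIV_diff[OF f1[OF that] DERIV_ident] that by (simp add: has_field_derivative_at_within)
  then obtain c2 where c2: "f z - z = c2" if "z \<in> S" for z
    using has_field_derivative_zero_constant[OF S(2), of "\<lambda>z. f z - z"] by blast
  show ?thesis using c2[OF z] c2[OF S(3)] f0 by simp
qed

subsection \<open>Invariant polynomial quadratic differentials\<close>

text \<open>Both sides of \<open>f o g = \<gamma> o f\<close> are expanded by the cocycle rule,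
  where the Schwarzians of the Moebius maps drop out. What remains is
  \<open>P(\<gamma> w) \<gamma>'(w)^2 = P(w)\<close> at \<open>w = f z\<close>, stated here with
  denominators cleared.\<close>

lemma polynomial_Schwarzian_equivariance:
  fixes a b c d A B C D :: complex
  assumes S: "open S" and f: "f holomorphic_on S" "\<And>z. z \<in> S \<Longrightarrow> deriv f z \<noteq> 0"
    and P: "\<And>z. z \<in> S \<Longrightarrow> Schwarzian f z = poly P (f z) * (deriv f z)\<^sup>2"
    and det: "a * d - b * c \<noteq> 0" and Det: "A * D - B * C \<noteq> 0"
    and g: "\<And>z. z \<in> S \<Longrightarrow> c * z + d \<noteq> 0 \<and> (a * z + b) / (c * z + d) \<in> S"
    and conj: "\<And>z. z \<in> S \<Longrightarrow> C * f z + D \<noteq> 0 \<and>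
      f ((a * z + b) / (c * z + d)) = (A * f z + B) / (C * f z + D)"
    and z: "z \<in> S"
  shows "poly P ((A * f z + B) / (C * f z + D)) * (A * D - B * C)\<^sup>2 = poly P (f z) * (C * f z + D) ^ 4"
proof -
  let ?g = "\<lambda>z. (a * z + b) / (c * z + d)" and ?\<gamma> = "\<lambda>w. (A * w + B) / (C * w + D)"
  let ?T = "{w. C * w + D \<noteq> 0}"
  have g_hol: "?g holomorphic_on S"
    using g by (intro holomorphic_intros) auto
  have \<gamma>_hol: "?\<gamma> holomorphic_on ?T"
    by (intro holomorphic_intros) auto
  have gS: "?g ` S \<subseteq> S" and fT: "f ` S \<subseteq> ?T" using g conj by auto
  have g': "deriv ?g u \<noteq> 0" if "u \<in> S" for u
    using g[OF that] det by (simp add: deriv_moebius)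
  have \<gamma>': "deriv ?\<gamma> w \<noteq> 0" if "w \<in> ?T" for w
    using that Det by (simp add: deriv_moebius)
  have gz: "?g z \<in> S" "c * z + d \<noteq> 0" and fz: "C * f z + D \<noteq> 0" "f (?g z) = ?\<gamma> (f z)"
    using g[OF z] conj[OF z] by auto
  have eq: "f (?g u) = ?\<gamma> (f u)" if "u \<in> S" for u using conj[OF that] by simp
  \<comment> \<open>The first derivative of the conjugation identity, used to eliminate the
    derivative of \<open>f\<close> at the image point.\<close>
  have d: "deriv f (?g z) * deriv ?g z = (A * D - B * C) / (C * f z + D)\<^sup>2 * deriv f z"
    using deriv_eq_on_open[OF S z eq] deriv_comp_on[OF S S g_hol f(1) gS z]
      deriv_comp_on[OF S open_moebius_domain f(1) \<gamma>_hol fT z] deriv_moebius[OF fz(1), of A B]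
    by simp
  have "Schwarzian f (?g z) * (deriv ?g z)\<^sup>2 + Schwarzian ?g z
      = Schwarzian ?\<gamma> (f z) * (deriv f z)\<^sup>2 + Schwarzian f z"
    using Schwarzian_eq_on_open[OF S z eq] Schwarzian_comp[OF S S g_hol f(1) gS g' f(2) z]
      Schwarzian_comp[OF S open_moebius_domain f(1) \<gamma>_hol fT f(2) \<gamma>' z]
    by simp
  then have "poly P (?\<gamma> (f z)) * (deriv f (?g z) * deriv ?g z)\<^sup>2 = poly P (f z) * (deriv f z)\<^sup>2"
    using Schwarzian_moebius[OF det gz(2)] Schwarzian_moebius[OF Det fz(1)] P[OF z] P[OF gz(1)] fz(2)
    by (simp add: power_mult_distrib mult.assoc)
  then have "poly P (?\<gamma> (f z)) * ((A * D - B * C) / (C * f z + D)\<^sup>2)\<^sup>2 = poly P (f z)"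
    unfolding d power_mult_distrib using f(2)[OF z] by simp
  then show ?thesis
    using fz(1) by (simp add: power_divide divide_eq_eq flip: power_mult)
qed

lemma poly_eq_if_infinite:
  fixes p q :: "'a :: idom poly"
  assumes "infinite W" "\<And>w. w \<in> W \<Longrightarrow> poly p w = poly q w"
  shows "p = q"
proof (rule ccontr)
  assume "p \<noteq> q"
  then have "finite {w. poly (p - q) w = 0}" by (intro poly_roots_finite) simp
  moreover have "W \<subseteq> {w. poly (p - q) w = 0}" using assms(2) by auto
  ultimately show False using assms(1) finite_subset by blast
qed

text \<open>Clearing denominators gives a polynomial identity. Evaluating it at the pole of the
  Moebius map excludes \<open>C \<noteq> 0\<close>; comparing coefficients of degree
  \<open>degree P\<close> then relates the powers of \<open>A\<close> and \<open>D\<close>.\<close>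

lemma moebius_invariant_polynomial:
  fixes P :: "'a :: field poly"
  assumes "P \<noteq> 0" and Det: "A * D - B * C \<noteq> 0" and "infinite W"
    and inv: "\<And>w. w \<in> W \<Longrightarrow> C * w + D \<noteq> 0 \<and>
       poly P ((A * w + B) / (C * w + D)) * (A * D - B * C)\<^sup>2 = poly P w * (C * w + D) ^ 4"
  shows "C = 0 \<and> (A / D) ^ (degree P + 2) = 1"
proof -
  define N where "N = degree P"
  \<comment> \<open>\<open>Q\<close> is the homogenisation of \<open>P\<close> evaluated at
    numerator and denominator, so it represents \<open>P(\<gamma> w) (C w + D)^N\<close> without
    division.\<close>
  define Q where "Q = (\<Sum>i\<le>N. smult (coeff P i) ([:B, A:] ^ i * [:D, C:] ^ (N - i)))"
  have Q: "poly Q w = poly P ((A * w + B) / (C * w + D)) * (C * w + D) ^ N" if "C * w + D \<noteq> 0" for w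
  proof -
    have "coeff P i * ((B + w * A) ^ i * (D + w * C) ^ (N - i))
        = coeff P i * ((A * w + B) / (C * w + D)) ^ i * (C * w + D) ^ N" if "i \<le> N" for i
    proof -
      have "(C * w + D) ^ N = (C * w + D) ^ i * (C * w + D) ^ (N - i)"
        using that by (simp flip: power_add)
      then show ?thesis
        using \<open>C * w + D \<noteq> 0\<close> by (simp add: power_divide add.commute mult.commute[of w])
    qed
    then show ?thesis
      unfolding Q_def poly_sum poly_altdef[of P] N_def[symmetric] sum_distrib_right
      by (intro sum.cong) auto
  qed
  have main: "smult ((A * D - B * C)\<^sup>2) Q = P * [:D, C:] ^ (N + 4)"
  proof (rule poly_eq_if_infinite[OF \<open>infinite W\<close>])
    fix w assume "w \<in> W"
    note w = inv[OF this]
    have "poly (smult ((A * D - B * C)\<^sup>2) Q) w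
        = (poly P ((A * w + B) / (C * w + D)) * (A * D - B * C)\<^sup>2) * (C * w + D) ^ N"
      using Q w by (simp add: mult_ac)
    also have "\<dots> = poly P w * (C * w + D) ^ (N + 4)"
      using w by (simp add: power_add mult_ac)
    finally show "poly (smult ((A * D - B * C)\<^sup>2) Q) w = poly (P * [:D, C:] ^ (N + 4)) w"
      by (simp add: add.commute mult.commute[of w])
  qed
  have lead: "coeff P N \<noteq> 0" using \<open>P \<noteq> 0\<close> by (simp add: N_def)
  have "C = 0"
  proof (rule ccontr)
    assume "C \<noteq> 0"
    define r where "r = - D / C"
    have r: "D + r * C = 0" using \<open>C \<noteq> 0\<close> by (simp add: r_def)
    have BA: "B + r * A \<noteq> 0" using \<open>C \<noteq> 0\<close> Det by (simp add: r_def field_simps)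
    \<comment> \<open>At the pole only the top summand survives, while the right-hand side of
      \<open>main\<close> vanishes there.\<close>
    have "poly Q r = (\<Sum>i\<le>N. if i = N then coeff P N * (B + r * A) ^ N else 0)"
      unfolding Q_def poly_sum by (intro sum.cong) (auto simp: r power_0_left)
    then have "poly Q r \<noteq> 0" using lead BA by simp
    moreover have "(A * D - B * C)\<^sup>2 * poly Q r = 0"
      using arg_cong[OF main, of "\<lambda>p. poly p r"] r by simp
    ultimately show False using Det by simp
  qed
  then have D0: "A \<noteq> 0" "D \<noteq> 0" using Det by auto
  \<comment> \<open>With \<open>C = 0\<close> the summand of index \<open>i\<close> has degree at
    most \<open>i\<close>, so only \<open>i = N\<close> reaches this coefficient.\<close>
  have "coeff Q N = coeff P N * A ^ N"
  proof -
    have "coeff ([:B, A:] ^ i * [:D, C:] ^ (N - i)) N = (if i = N then A ^ N else 0)" if "i \<le> N" for i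
    proof -
      have "[:D, C:] ^ (N - i) = [:D ^ (N - i):]" using \<open>C = 0\<close> by (simp add: poly_const_pow)
      moreover have "degree ([:B, A:] ^ i) = i" using D0 by (simp add: degree_power_eq)
      moreover have "lead_coeff ([:B, A:] ^ i) = A ^ i" using D0 by (simp add: lead_coeff_power)
      ultimately show ?thesis using that by (auto simp: coeff_eq_0)
    qed
    then have "coeff Q N = (\<Sum>i\<le>N. if i = N then coeff P N * A ^ N else 0)"
      unfolding Q_def coeff_sum by (intro sum.cong) auto
    then show ?thesis by simp
  qed
  moreover have "coeff (P * [:D, C:] ^ (N + 4)) N = coeff P N * D ^ (N + 4)"
    using \<open>C = 0\<close> by (simp add: poly_const_pow mult.commute)
  ultimately have "(A * D)\<^sup>2 * (coeff P N * A ^ N) = coeff P N * D ^ (N + 4)"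
    using arg_cong[OF main, of "\<lambda>p. coeff p N"] \<open>C = 0\<close> by simp
  then have "coeff P N * D\<^sup>2 * A ^ (N + 2) = coeff P N * D\<^sup>2 * D ^ (N + 2)"
    by (simp add: power_mult_distrib power_add mult_ac power4_eq_xxxx power2_eq_square)
  then have "A ^ (N + 2) = D ^ (N + 2)" using lead D0 by simp
  then show ?thesis using \<open>C = 0\<close> D0 by (simp add: power_divide N_def)
qed

subsection \<open>Orbits on the Riemann sphere\<close>

lemma topspace_Riemann_sphere [simp]: "topspace Riemann_sphere = UNIV"
  by (auto simp: Riemann_sphere_def) (metis not_None_eq rangeI)

lemma openin_Riemann_sphere_Some: "open V \<Longrightarrow> openin Riemann_sphere (Some ` V)"
  by (simp add: Riemann_sphere_def)

lemma t1_space_Riemann_sphere: "t1_space Riemann_sphere"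
  by (simp add: Riemann_sphere_def Hausdorff_imp_t1_space)

text \<open>A neighbourhood of infinity contains the complement of a compact set, which is nonempty
  since the plane is not compact. Hence a set of discontinuity always contains a disc in the
  plane.\<close>

lemma openin_Riemann_sphere_contains_ball:
  assumes "openin Riemann_sphere U" "U \<noteq> {}"
  obtains x r where "r > 0" "Some ` ball x r \<subseteq> U"
proof -
  obtain V where V: "open V" "V \<noteq> {}" "Some ` V \<subseteq> U"
  proof -
    consider V where "open V" "U = Some ` V"
      | C where "compact C" "U = insert None (Some ` (- C))"
      using assms(1) unfolding Riemann_sphere_def openin_Alexandroff_compactification
      by (auto simp: Compl_eq_Diff_UNIV)
    then show thesis
    proof cases
      case 1
      then show thesis using that assms(2) by blast
    next
      case 2
      have "open (- C)" using 2(1) by (simp add: compact_imp_closed open_Compl)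
      moreover have "- C \<noteq> {}" using 2(1) not_compact_UNIV by (metis Compl_UNIV_eq double_complement)
      ultimately show thesis using that 2(2) by blast
    qed
  qed
  then show thesis using that by (metis all_not_in_conv image_mono open_contains_ball subset_trans)
qed

text \<open>Accumulation at \<open>x\<close> depends only on the part of \<open>S\<close> inside
  \<open>U\<close>, and finite sets have no accumulation points in a T1 space.\<close>

lemma infinite_if_derived_set:
  assumes "t1_space X" "x \<in> X derived_set_of S" "openin X U" "x \<in> U"
  shows "infinite (S \<inter> U)"
proof
  assume "finite (S \<inter> U)"
  then have "X derived_set_of (S \<inter> U) = {}"
    using assms(1) t1_space_derived_set_of_finite by blast
  moreover have "x \<in> X derived_set_of (S \<inter> U)"
    unfolding in_derived_set_of
  proof (intro conjI allI impI)
    show "x \<in> topspace X" using assms(2) by (simp add: in_derived_set_of)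
    fix T assume "x \<in> T \<and> openin X T"
    then have "x \<in> T \<inter> U" "openin X (T \<inter> U)" using assms(3,4) by auto
    then show "\<exists>y. y \<noteq> x \<and> y \<in> S \<inter> U \<and> y \<in> T"
      using assms(2) unfolding in_derived_set_of by blast
  qed
  ultimately show False by simp
qed

lemma moebius_map_affine_Some: "moebius_map \<alpha> \<beta> 0 1 (Some z) = Some (\<alpha> * z + \<beta>)"
  by (simp add: moebius_map_def)

lemma inj_moebius_map_affine: "\<alpha> \<noteq> 0 \<Longrightarrow> inj (moebius_map \<alpha> \<beta> 0 1)"
  by (auto simp: inj_def moebius_map_def split: option.splits)

text \<open>Two elements with the same linear part that send \<open>y\<close> close to the same point differ by a
  short translation, and short translations do not move a small disc of discontinuity off itself.\<close>

lemma affine_Kleinian_group_orbit_no_finite_limit: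
  assumes "Kleinian_group \<Gamma>" and "finite E" "0 \<notin> E"
    and affine: "\<And>\<gamma>. \<gamma> \<in> \<Gamma> \<Longrightarrow> \<exists>\<alpha>\<in>E. \<exists>\<beta>. \<gamma> = moebius_map \<alpha> \<beta> 0 1"
  shows "Some L \<notin> Riemann_sphere derived_set_of {\<gamma> (Some y) |\<gamma>. \<gamma> \<in> \<Gamma>}"
proof
  assume L: "Some L \<in> Riemann_sphere derived_set_of {\<gamma> (Some y) |\<gamma>. \<gamma> \<in> \<Gamma>}"
  obtain U where U: "openin Riemann_sphere U" "U \<noteq> {}" "finite {g \<in> \<Gamma>. g ` U \<inter> U \<noteq> {}}"
    using assms(1) unfolding Kleinian_group_def region_of_discontinuity_def by blast
  obtain x r where r: "r > 0" and xU: "Some ` ball x r \<subseteq> U"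
    using openin_Riemann_sphere_contains_ball[OF U(1,2)] .
  \<comment> \<open>Half the radius of the disc of discontinuity, so that any two of these images of
    \<open>y\<close> are less than \<open>r\<close> apart.\<close>
  define \<Delta> where "\<Delta> = {\<gamma> \<in> \<Gamma>. \<gamma> (Some y) \<in> Some ` ball L (r / 2)}"
  have "infinite ({\<gamma> (Some y) |\<gamma>. \<gamma> \<in> \<Gamma>} \<inter> Some ` ball L (r / 2))"
    using r by (intro infinite_if_derived_set[OF t1_space_Riemann_sphere L]
        openin_Riemann_sphere_Some) auto
  moreover have "{\<gamma> (Some y) |\<gamma>. \<gamma> \<in> \<Gamma>} \<inter> Some ` ball L (r / 2) \<subseteq> (\<lambda>\<gamma>. \<gamma> (Some y)) ` \<Delta>"
    unfolding \<Delta>_def by blast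
  ultimately have "infinite \<Delta>"
    using finite_surj by blast
  obtain lin where lin: "lin \<gamma> \<in> E" "\<exists>\<beta>. \<gamma> = moebius_map (lin \<gamma>) \<beta> 0 1" if "\<gamma> \<in> \<Gamma>" for \<gamma>
    using affine by metis
  \<comment> \<open>Only finitely many linear parts occur, so infinitely many elements of
    \<open>\<Delta>\<close> share one by the pigeonhole principle.\<close>
  have "finite (lin ` \<Delta>)"
    using lin(1) \<open>finite E\<close> by (auto simp: \<Delta>_def intro: finite_subset)
  then obtain \<gamma>0 where \<gamma>0: "\<gamma>0 \<in> \<Delta>" and inf: "infinite {\<gamma> \<in> \<Delta>. lin \<gamma> = lin \<gamma>0}"
    using pigeonhole_infinite[OF \<open>infinite \<Delta>\<close>] by blast
  define \<alpha> where "\<alpha> = lin \<gamma>0"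
  have \<gamma>0\<Gamma>: "\<gamma>0 \<in> \<Gamma>" using \<gamma>0 by (simp add: \<Delta>_def)
  have "\<alpha> \<noteq> 0" using lin(1)[OF \<gamma>0\<Gamma>] \<open>0 \<notin> E\<close> by (auto simp: \<alpha>_def)
  obtain \<beta>0 where \<beta>0: "\<gamma>0 = moebius_map \<alpha> \<beta>0 0 1"
    using lin(2)[OF \<gamma>0\<Gamma>] by (auto simp: \<alpha>_def)
  have inj: "inj \<gamma>0" using inj_moebius_map_affine[OF \<open>\<alpha> \<noteq> 0\<close>] \<beta>0 by simp
  have "\<gamma>0 (Some ((x - \<beta>0) / \<alpha>)) = Some x"
    using \<open>\<alpha> \<noteq> 0\<close> by (simp add: \<beta>0 moebius_map_affine_Some)
  then have inv0: "inv \<gamma>0 (Some x) = Some ((x - \<beta>0) / \<alpha>)"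
    by (metis inj inv_f_f)
  \<comment> \<open>Each such composition is the translation by \<open>\<beta> - \<beta>0\<close>,
    which is shorter than \<open>r\<close> and so keeps the centre \<open>x\<close> inside
    \<open>U\<close>.\<close>
  have "(\<lambda>\<gamma>. \<gamma> \<circ> inv \<gamma>0) ` {\<gamma> \<in> \<Delta>. lin \<gamma> = \<alpha>} \<subseteq> {g \<in> \<Gamma>. g ` U \<inter> U \<noteq> {}}"
  proof clarsimp
    fix \<gamma> assume "\<gamma> \<in> \<Delta>" and \<alpha>: "\<alpha> = lin \<gamma>"
    then have "\<gamma> \<in> \<Gamma>" by (simp add: \<Delta>_def)
    then obtain \<beta> where \<beta>: "\<gamma> = moebius_map \<alpha> \<beta> 0 1" using lin(2) \<alpha> by blast
    have "dist L (\<alpha> * y + \<beta>) < r / 2" "dist L (\<alpha> * y + \<beta>0) < r / 2"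
      using \<open>\<gamma> \<in> \<Delta>\<close> \<gamma>0 by (auto simp: \<Delta>_def \<beta> \<beta>0 moebius_map_affine_Some)
    then have "dist (\<alpha> * y + \<beta>0) (\<alpha> * y + \<beta>) < r"
      using dist_triangle_half_r dist_commute by metis
    then have "x + (\<beta> - \<beta>0) \<in> ball x r" by (simp add: dist_norm norm_minus_commute)
    moreover have "\<gamma> (inv \<gamma>0 (Some x)) = Some (x + (\<beta> - \<beta>0))"
      using \<open>\<alpha> \<noteq> 0\<close> by (simp add: inv0 \<beta> moebius_map_affine_Some)
    ultimately have "\<gamma> (inv \<gamma>0 (Some x)) \<in> U" "Some x \<in> U" using xU r by auto
    then have "(\<lambda>u. \<gamma> (inv \<gamma>0 u)) ` U \<inter> U \<noteq> {}" by blast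
    moreover have "\<gamma> \<circ> inv \<gamma>0 \<in> \<Gamma>"
      using assms(1) \<open>\<gamma> \<in> \<Gamma>\<close> \<gamma>0\<Gamma> by (simp add: Kleinian_group_def moebius_group_def)
    ultimately show "\<gamma> \<circ> inv \<gamma>0 \<in> \<Gamma> \<and> (\<lambda>u. \<gamma> (inv \<gamma>0 u)) ` U \<inter> U \<noteq> {}" by blast
  qed
  \<comment> \<open>Distinct elements give distinct translations, so the finiteness at
    \<open>U\<close> contradicts the pigeonhole choice.\<close>
  moreover have "inj_on (\<lambda>\<gamma>. \<gamma> \<circ> inv \<gamma>0) {\<gamma> \<in> \<Delta>. lin \<gamma> = \<alpha>}"
  proof (rule inj_onI)
    fix \<gamma> \<gamma>' assume "\<gamma> \<circ> inv \<gamma>0 = \<gamma>' \<circ> inv \<gamma>0"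
    then have "\<gamma> \<circ> (inv \<gamma>0 \<circ> \<gamma>0) = \<gamma>' \<circ> (inv \<gamma>0 \<circ> \<gamma>0)" by (simp only: o_assoc)
    then show "\<gamma> = \<gamma>'" using inj by simp
  qed
  ultimately have "finite {\<gamma> \<in> \<Delta>. lin \<gamma> = \<alpha>}"
    using U(3) by (meson finite_imageD finite_subset)
  then show False using inf by (simp add: \<alpha>_def)
qed

section \<open>Vanishing of the polynomial for groups of the first kind\<close>

lemma moebius_map_Some_eq_Some:
  "moebius_map a b c d (Some z) = Some w \<longleftrightarrow> c * z + d \<noteq> 0 \<and> w = (a * z + b) / (c * z + d)"
  by (auto simp: moebius_map_def)

lemma moebius_map_affine:
  "moebius_map a b 0 d = moebius_map (a / d) (b / d) 0 1" if "d \<noteq> 0"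
  using that by (auto simp: fun_eq_iff moebius_map_def add_divide_distrib split: option.split)

lemma polynomial_Schwarzian_eq_zero:
  assumes G: "Fuchsian_group_first_kind G"
    and f: "f holomorphic_on ball 0 1" "inj_on f (ball 0 1)"
    and w: "homeomorphic_map Riemann_sphere Riemann_sphere w"
      "\<And>z. z \<in> ball 0 1 \<Longrightarrow> w (Some z) = Some (f z)"
    and K: "Kleinian_group {w \<circ> g \<circ> inv w |g. g \<in> G}"
    and P: "\<And>z. z \<in> ball 0 1 \<Longrightarrow> Schwarzian f z = poly P (f z) * (deriv f z)\<^sup>2"
  shows "P = 0"
proof (rule ccontr)
  assume "P \<noteq> 0"
  define m where "m = degree P + 2"
  define \<Gamma> where "\<Gamma> = {w \<circ> g \<circ> inv w |g. g \<in> G}"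
  have f': "deriv f z \<noteq> 0" if "z \<in> ball 0 1" for z
    using holomorphic_injective_imp_regular[OF f(1) open_ball f(2) that] .
  \<comment> \<open>Supplies the infinitely many points at which the invariance of \<open>P\<close>
    becomes a polynomial identity.\<close>
  have "infinite (f ` ball 0 1)"
    using uncountable_ball[of 1 "0 :: complex"] countable_finite finite_imageD[OF _ f(2)]
      zero_less_one by blast
  have injw: "inj w"
    using w(1) by (auto dest: homeomorphic_imp_injective_map)
  have w_inv: "inv w (w x) = x" for x using injw by simp
  have affine: "\<exists>\<alpha>\<in>{\<alpha>. \<alpha> ^ m = 1}. \<exists>\<beta>. \<gamma> = moebius_map \<alpha> \<beta> 0 1" if "\<gamma> \<in> \<Gamma>" for \<gamma>
  proof -
    obtain g where g: "g \<in> G" "\<gamma> = w \<circ> g \<circ> inv w" using \<open>\<gamma> \<in> \<Gamma>\<close> by (auto simp: \<Gamma>_def)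
    have "is_moebius \<gamma>"
      using K \<open>\<gamma> \<in> \<Gamma>\<close> by (simp add: \<Gamma>_def Kleinian_group_def moebius_group_def)
    then obtain A B C D where Det: "A * D - B * C \<noteq> 0" and \<gamma>: "\<gamma> = moebius_map A B C D"
      by (auto simp: is_moebius_def)
    have "is_moebius g" and gD: "g ` (Some ` ball 0 1) = Some ` ball 0 1"
      using G g(1) by (auto simp: Fuchsian_group_first_kind_def Fuchsian_group_def
          Kleinian_group_def moebius_group_def)
    then obtain a b c d where det: "a * d - b * c \<noteq> 0" and g_eq: "g = moebius_map a b c d"
      by (auto simp: is_moebius_def)
    have gz: "\<exists>u\<in>ball 0 1. g (Some z) = Some u" if "z \<in> ball 0 1" for z
      using gD that by blast
    have disc: "c * z + d \<noteq> 0 \<and> (a * z + b) / (c * z + d) \<in> ball 0 1" if "z \<in> ball 0 1" for z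
      using gz[OF that] unfolding g_eq moebius_map_Some_eq_Some by blast
    \<comment> \<open>Since \<open>w\<close> extends \<open>f\<close>, the conjugate of
      \<open>g\<close> acts on the image of the disc as \<open>f o g o f^(-1)\<close>.\<close>
    have conj: "C * f z + D \<noteq> 0 \<and>
        f ((a * z + b) / (c * z + d)) = (A * f z + B) / (C * f z + D)" if z: "z \<in> ball 0 1" for z
    proof -
      have "g (Some z) = Some ((a * z + b) / (c * z + d))"
        using disc[OF z] by (simp add: g_eq moebius_map_Some_eq_Some)
      then have "\<gamma> (Some (f z)) = Some (f ((a * z + b) / (c * z + d)))"
        using w(2)[OF z] w(2) disc[OF z] w_inv[of "Some z"] by (simp add: g(2))
      then show ?thesis unfolding \<gamma> moebius_map_Some_eq_Some .
    qed
    have "C = 0 \<and> (A / D) ^ (degree P + 2) = 1"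
    proof (rule moebius_invariant_polynomial[OF \<open>P \<noteq> 0\<close> Det \<open>infinite (f ` ball 0 1)\<close>])
      fix v assume "v \<in> f ` ball 0 1"
      then obtain z where z: "z \<in> ball 0 1" "v = f z" by blast
      show "C * v + D \<noteq> 0 \<and>
        poly P ((A * v + B) / (C * v + D)) * (A * D - B * C)\<^sup>2 = poly P v * (C * v + D) ^ 4"
        unfolding z(2)
      proof
        show "C * f z + D \<noteq> 0" using conj[OF z(1)] by blast
        show "poly P ((A * f z + B) / (C * f z + D)) * (A * D - B * C)\<^sup>2
            = poly P (f z) * (C * f z + D) ^ 4"
          by (rule polynomial_Schwarzian_equivariance[where f = f and S = "ball 0 1" and P = P
                and a = a and b = b and c = c and d = d])
             (rule open_ball f(1) det Det z(1) | erule f' P disc conj)+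
      qed
    qed
    then have "C = 0" and root: "(A / D) ^ m = 1" and "D \<noteq> 0" using Det by (auto simp: m_def)
    have "\<gamma> = moebius_map (A / D) (B / D) 0 1"
      unfolding \<gamma> \<open>C = 0\<close> by (rule moebius_map_affine[OF \<open>D \<noteq> 0\<close>])
    then show ?thesis using root by blast
  qed
  have E: "finite {\<alpha>::complex. \<alpha> ^ m = 1}" "0 \<notin> {\<alpha>::complex. \<alpha> ^ m = 1}"
    by (rule finite_roots_unity) (auto simp: m_def)
  \<comment> \<open>The map \<open>w\<close> may send one point of the circle to infinity, but by
    injectivity not both 1 and -1.\<close>
  obtain s L where s: "s \<in> sphere 0 1" "w (Some s) = Some L"
  proof -
    have "w (Some 1) \<noteq> w (Some (- 1))" using injD[OF injw, of "Some 1" "Some (- 1)"] by auto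
    then consider "w (Some 1) \<noteq> None" | "w (Some (- 1)) \<noteq> None" by metis
    then show thesis
      by cases (use that[of 1] that[of "- 1"] in auto)
  qed
  then have "Some s \<in> Fuchsian_limit_set G"
    using G by (simp add: Fuchsian_group_first_kind_def)
  then obtain z where z: "z \<in> ball 0 1"
    and sz: "Some s \<in> Riemann_sphere derived_set_of {g (Some z) |g. g \<in> G}"
    unfolding Fuchsian_limit_set_def by blast
  \<comment> \<open>The orbit of \<open>f z\<close> under the conjugated group is the image of the
    orbit of \<open>z\<close>, and the homeomorphism \<open>w\<close> carries accumulation points
    along, producing the forbidden finite limit point \<open>L\<close>.\<close>
  have "w ` {g (Some z) |g. g \<in> G} = {\<gamma> (Some (f z)) |\<gamma>. \<gamma> \<in> \<Gamma>}"
    unfolding \<Gamma>_def Setcompr_eq_image image_image by (simp add: w(2)[OF z, symmetric] w_inv)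
  moreover have "Riemann_sphere derived_set_of (w ` {g (Some z) |g. g \<in> G})
      = w ` (Riemann_sphere derived_set_of {g (Some z) |g. g \<in> G})"
    by (rule homeomorphic_map_derived_set_of[OF w(1)]) simp
  ultimately have "Some L \<in> Riemann_sphere derived_set_of {\<gamma> (Some (f z)) |\<gamma>. \<gamma> \<in> \<Gamma>}"
    using imageI[OF sz, of w] s(2) by simp
  moreover have "Some L \<notin> Riemann_sphere derived_set_of {\<gamma> (Some (f z)) |\<gamma>. \<gamma> \<in> \<Gamma>}"
    by (rule affine_Kleinian_group_orbit_no_finite_limit[OF K[folded \<Gamma>_def] E], erule affine)
  ultimately show False by contradiction
qed

section \<open>The identity lies in the intersection\<close>

lemma id_in_Teichmueller_schlicht:
  assumes "Kleinian_group G"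
  shows "restrict (\<lambda>z. z) (ball 0 1) \<in> Teichmueller_schlicht G"
proof -
  let ?f = "restrict (\<lambda>z. z) (ball 0 1) :: complex \<Rightarrow> complex"
  have f1: "deriv ?f z = 1" if "z \<in> ball 0 1" for z
    using deriv_eq_on_open[OF open_ball that, of ?f "\<lambda>z. z"] by simp
  have f2: "deriv (deriv ?f) z = 0" if "z \<in> ball 0 1" for z
    using deriv_eq_on_open[OF open_ball that f1] by simp
  have "?f holomorphic_on ball 0 1"
    using holomorphic_on_ident by (rule holomorphic_transform) simp
  moreover have "{id \<circ> g \<circ> inv id |g. g \<in> G} = G" by simp
  \<comment> \<open>The extension is the identity of the sphere, under which the conjugated group is
    \<open>G\<close> itself.\<close>
  ultimately show ?thesis
    unfolding Teichmueller_schlicht_def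
    using f1[of 0] f2[of 0] quasiconformal_sphere_id assms
    by (auto simp: inj_on_def intro!: exI[of _ id])
qed

text \<open>Each term of the recursion vanishes on the open disc, where the derivative of the
  previous order is that of the zero function.\<close>

lemma higher_Schwarzian_A_id:
  assumes "z \<in> ball 0 1"
  shows "higher_Schwarzian_A n (restrict (\<lambda>z. z) (ball 0 1)) z = 0"
proof -
  let ?f = "restrict (\<lambda>z. z) (ball 0 1) :: complex \<Rightarrow> complex"
  have f1: "deriv ?f z = 1" if "z \<in> ball 0 1" for z
    using deriv_eq_on_open[OF open_ball that, of ?f "\<lambda>z. z"] by simp
  have f2: "deriv (deriv ?f) z = 0" if "z \<in> ball 0 1" for z
    using deriv_eq_on_open[OF open_ball that f1] by simp
  have p: "pre_Schwarzian ?f z = 0" if "z \<in> ball 0 1" for z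
    using f2[OF that] by (simp add: pre_Schwarzian_def)
  have S: "Schwarzian ?f z = 0" if "z \<in> ball 0 1" for z
    using deriv_eq_on_open[OF open_ball that p] p[OF that] by (simp add: Schwarzian_def)
  show ?thesis
    using assms
  proof (induction n arbitrary: z)
    case (Suc n)
    have "deriv (higher_Schwarzian_A n ?f) z = 0"
      using deriv_eq_on_open[OF open_ball Suc.prems, of "higher_Schwarzian_A n ?f" "\<lambda>_. 0"] Suc.IH
      by (simp del: restrict_apply)
    then show ?case
      using p[OF Suc.prems] S[OF Suc.prems] by (simp del: restrict_apply)
  qed (use S in simp)
qed

theorem theorem4p27:
  fixes G :: "(sphere_point \<Rightarrow> sphere_point) set" and n :: nat
  assumes "Fuchsian_group_first_kind G"
    and "n \<ge> 3"
  shows "{f. \<forall>z\<in>ball 0 1. higher_Schwarzian_A n f z = 0} \<inter> Teichmueller_schlicht G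
         = {restrict (\<lambda>z. z) (ball 0 1)}"
proof (intro equalityI subsetI)
  fix f assume "f \<in> {f. \<forall>z\<in>ball 0 1. higher_Schwarzian_A n f z = 0} \<inter> Teichmueller_schlicht G"
  then obtain w where zero: "\<And>z. z \<in> ball 0 1 \<Longrightarrow> higher_Schwarzian_A n f z = 0"
    and f: "f \<in> extensional (ball 0 1)" "f holomorphic_on ball 0 1" "inj_on f (ball 0 1)"
    and f0: "f 0 = 0" "deriv f 0 = 1" "deriv (deriv f) 0 = 0"
    and w: "quasiconformal_sphere w" "\<And>z. z \<in> ball 0 1 \<Longrightarrow> w (Some z) = Some (f z)"
      "Kleinian_group {w \<circ> g \<circ> inv w |g. g \<in> G}"
    by (auto simp: Teichmueller_schlicht_def)
  have f': "deriv f z \<noteq> 0" if "z \<in> ball 0 1" for z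
    using holomorphic_injective_imp_regular[OF f(2) open_ball f(3) that] .
  obtain P where P: "Schwarzian f z = poly P (f z) * (deriv f z)\<^sup>2" if "z \<in> ball 0 1" for z
    using higher_Schwarzian_A_zero_imp_polynomial[OF open_ball convex_ball f(2) f' assms(2) zero]
    by blast
  have "homeomorphic_map Riemann_sphere Riemann_sphere w"
    using w(1) by (simp add: quasiconformal_sphere_def)
  from polynomial_Schwarzian_eq_zero[OF assms(1) f(2,3) this w(2,3) P]
  have S0: "Schwarzian f z = 0" if "z \<in> ball 0 1" for z using P[OF that] by simp
  have "f z = z" if "z \<in> ball 0 1" for z
    using Schwarzian_zero_imp_id[OF open_ball convex_ball _ f(2) f' f0 S0 that] by simp
  \<comment> \<open>Equality on the disc extends to all arguments because both functions are
    \<open>undefined\<close> outside it.\<close>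
  then have "f = restrict (\<lambda>z. z) (ball 0 1)"
    using f(1) by (intro extensionalityI[of _ "ball 0 1"]) auto
  then show "f \<in> {restrict (\<lambda>z. z) (ball 0 1)}" by simp
next
  fix f assume "f \<in> {restrict (\<lambda>z::complex. z) (ball 0 1)}"
  moreover have "Kleinian_group G"
    using assms(1) by (simp add: Fuchsian_group_first_kind_def Fuchsian_group_def)
  ultimately show "f \<in> {f. \<forall>z\<in>ball 0 1. higher_Schwarzian_A n f z = 0} \<inter> Teichmueller_schlicht G"
    using id_in_Teichmueller_schlicht higher_Schwarzian_A_id by blast
qed

end
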